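(* Let $K$ be a convex set that is affinely isomorphic to the state space of a JB algebra. If $K$ is not a simplex, then the set $\partial_e K$ of extreme points of $K$ has cardinality at least that of $\mathbb{R}$.
   Context: A Jordan algebra is a real vector space with a commutative bilinear product $\circ$ satisfying $((A\circ A)\circ B)\circ A=(A\circ A)\circ(B\circ A)$. A JB algebra is a unital Jordan algebra complete with respect to a norm satisfying $\|A\circ B\|\le\|A\|\|B\|$, $\|A\circ A\|=\|A\|^2$, $\|A\circ A\|\le\|A\circ A+B\circ B\|$. A state is a continuous linear $\omega:\mathcal{A}\to\mathbb{R}$ with $\omega(I)=1$ and $\omega(A\circ A)\ge0$; the state space is the convex set of states. An affine isomorphism is a bijection preserving convex combinations. $K$ is called a simplex if for all extreme points $w,x,y,z$ of $K$ and $\lambda,\mu\in(0,1)$, $\lambda w+(1-\lambda)x=\mu y+(1-\mu)z$ implies $w=y$ or $w=z$. *)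

theory Defs
  imports "HOL-Analysis.Analysis"
begin

definition JB_algebra :: "('a::banach \<Rightarrow> 'a \<Rightarrow> 'a) \<Rightarrow> 'a \<Rightarrow> bool" where
  "JB_algebra jp u \<longleftrightarrow>
     bilinear jp \<and>
     (\<forall>A B. jp A B = jp B A) \<and>
     (\<forall>A B. jp (jp (jp A A) B) A = jp (jp A A) (jp B A)) \<and>
     (\<forall>A. jp u A = A) \<and>
     (\<forall>A B. norm (jp A B) \<le> norm A * norm B) \<and>
     (\<forall>A. norm (jp A A) = (norm A)\<^sup>2) \<and>
     (\<forall>A B. norm (jp A A) \<le> norm (jp A A + jp B B))"

definition state_space :: "('a::banach \<Rightarrow> 'a \<Rightarrow> 'a) \<Rightarrow> 'a \<Rightarrow> ('a \<Rightarrow> real) set" where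
  "state_space jp u =
     {\<omega>. linear \<omega> \<and> continuous_on UNIV \<omega> \<and> \<omega> u = 1 \<and> (\<forall>A. \<omega> (jp A A) \<ge> 0)}"

definition affine_iso_fun :: "('f \<Rightarrow> real) set \<Rightarrow> 'b::real_vector set \<Rightarrow> (('f \<Rightarrow> real) \<Rightarrow> 'b) \<Rightarrow> bool" where
  "affine_iso_fun S K \<phi> \<longleftrightarrow>
     bij_betw \<phi> S K \<and>
     (\<forall>x\<in>S. \<forall>y\<in>S. \<forall>t::real. 0 \<le> t \<and> t \<le> 1 \<longrightarrow>
        \<phi> (\<lambda>A. t * x A + (1 - t) * y A) = t *\<^sub>R \<phi> x + (1 - t) *\<^sub>R \<phi> y)"

definition is_simplex :: "'b::real_vector set \<Rightarrow> bool" where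
  "is_simplex K \<longleftrightarrow>
     (\<forall>w x y z. w extreme_point_of K \<longrightarrow> x extreme_point_of K \<longrightarrow>
        y extreme_point_of K \<longrightarrow> z extreme_point_of K \<longrightarrow>
        (\<forall>s t::real. 0 < s \<and> s < 1 \<and> 0 < t \<and> t < 1 \<longrightarrow>
           s *\<^sub>R w + (1 - s) *\<^sub>R x = t *\<^sub>R y + (1 - t) *\<^sub>R z \<longrightarrow> w = y \<or> w = z))"

end

theory Submission
  imports Defs
begin

text \<open>
  For elements \<open>a\<close>, \<open>b\<close> of a Jordan algebra the commutator \<open>D = [L\<^sub>a, L\<^sub>b]\<close> of multiplication
  operators is a derivation, so the operators \<open>exp (t D)\<close> are automorphisms and act on the pure states.
  If some pure state \<open>w\<close> satisfies \<open>w \<circ> D \<noteq> 0\<close>, then \<open>t \<mapsto> w \<circ> exp (t D)\<close> is a nonconstant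
  continuous curve of pure states, which has continuum many points.

  Otherwise \<open>w(a(bc))\<close> is symmetric for every pure \<open>w\<close>, and the multiplication operators are symmetric
  for the semidefinite form \<open>w(ab)\<close>. Submultiplicativity of the norm bounds them by \<open>\<parallel>a\<parallel>\<close> for this
  form, and \<open>\<parallel>u - b\<^sup>2\<parallel> \<le> 1\<close> for small \<open>b\<close> then gives \<open>w(b\<^sup>2 c\<^sup>2) \<ge> 0\<close>. By purity
  \<open>w\<close> is multiplicative. Distinct multiplicative states are linearly independent, which rules out
  the relation between four pure states that witnesses the failure of the simplex property.
\<close>

section \<open>Exponentials of bounded operators\<close>

text \<open>On an interval around a zero whose length is set by the bound of \<open>D\<close>, the
  mean value inequality bounds the maximum of \<open>norm (F s)\<close> by half of itself. The zero
  set is therefore open; it is also closed and the line is connected. This uniqueness principle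
  proves all the identities for \<open>op_exp\<close> below.\<close>

lemma linear_ode_zero:
  fixes F :: "real \<Rightarrow> 'a::real_normed_vector"
  assumes D: "bounded_linear D"
    and F: "\<And>t. (F has_vector_derivative D (F t)) (at t)"
    and F0: "F 0 = 0"
  shows "F t = 0"
proof -
  obtain k where k: "k > 0" "\<And>x. norm (D x) \<le> norm x * k"
    using bounded_linear.pos_bounded[OF D] by blast
  \<comment> \<open>This radius makes the Lipschitz estimate contract by exactly 1/2.\<close>
  define d where "d = 1 / (2 * k)"
  have d: "d > 0" "k * d = 1/2" using k by (auto simp: d_def)
  have contF: "continuous_on S F" for S
    using F has_vector_derivative_continuous continuous_at_imp_continuous_on by blast
  have loc: "F s = 0" if a: "F a = 0" and s: "s \<in> cball a d" for a s
  proof -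
    obtain m where m: "m \<in> cball a d" "\<And>y. y \<in> cball a d \<Longrightarrow> norm (F y) \<le> norm (F m)"
      using continuous_attains_sup[OF compact_cball _ continuous_on_norm[OF contF], of a d] d(1)
      by (auto simp del: mem_cball)
    have "norm (F m - F a) \<le> (norm (F m) * k) * norm (m - a)"
    proof (rule differentiable_bound[of "cball a d" F "\<lambda>x h. h *\<^sub>R D (F x)"])
      show "(F has_derivative (\<lambda>h. h *\<^sub>R D (F x))) (at x within cball a d)" for x
        using F[of x] by (simp add: has_vector_derivative_def has_derivative_at_withinI)
      show "onorm (\<lambda>h. h *\<^sub>R D (F x)) \<le> norm (F m) * k" if "x \<in> cball a d" for x
      proof (rule onorm_le)
        fix h :: real
        have "norm (D (F x)) \<le> norm (F m) * k"
          using k(2)[of "F x"] m(2)[OF that] k(1)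
          by (meson mult_le_cancel_right_pos order_trans)
        then show "norm (h *\<^sub>R D (F x)) \<le> norm (F m) * k * norm h"
          by (simp add: mult.commute mult_left_mono)
      qed
    qed (use m d in auto)
    also have "\<dots> \<le> (norm (F m) * k) * d"
      using m(1) k(1) by (intro mult_left_mono) (auto simp: dist_norm norm_minus_commute)
    finally have "norm (F m) \<le> norm (F m) * (1/2)"
      using a d(2) by (simp add: mult.assoc)
    then have "F m = 0" by simp
    then show ?thesis using m(2)[OF s] by simp
  qed
  have "open {t. F t = 0}"
    unfolding open_contains_cball using loc d(1) by blast
  moreover have "closed {t. F t = 0}"
    using closed_Collect_eq[OF contF[of UNIV] continuous_on_const] by simp
  ultimately have "{t. F t = 0} = {} \<or> {t. F t = 0} = UNIV"
    by (intro iffD1[OF clopen] conjI)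
  then show ?thesis using F0 by auto
qed

definition op_exp :: "('a::banach \<Rightarrow> 'a) \<Rightarrow> real \<Rightarrow> 'a \<Rightarrow> 'a" where
  "op_exp D t x = (\<Sum>n. (t ^ n / fact n) *\<^sub>R (D ^^ n) x)"

context
  fixes D :: "'a::banach \<Rightarrow> 'a"
  assumes D: "bounded_linear D"
begin

lemma bounded_linear_funpow: "bounded_linear (D ^^ n)"
proof (induction n)
  case 0
  then show ?case using bounded_linear_ident by (simp add: id_def)
next
  case (Suc n)
  then show ?case using bounded_linear_compose[OF D] by (simp add: o_def)
qed

text \<open>The terms are dominated by a real exponential series. One \<open>k\<close> serves all
  \<open>n\<close>, \<open>x\<close> and \<open>t\<close>, so the same majorant gives summability,
  boundedness and uniform convergence on bounded intervals.\<close>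

lemma op_exp_bound:
  obtains k where "k > 0" "\<And>n x t. norm ((t ^ n / fact n) *\<^sub>R (D ^^ n) x) \<le> (\<bar>t\<bar> * k) ^ n /\<^sub>R fact n * norm x"
proof -
  obtain k where k: "k > 0" "\<And>x. norm (D x) \<le> norm x * k"
    using bounded_linear.pos_bounded[OF D] by blast
  have *: "norm ((D ^^ n) x) \<le> k ^ n * norm x" for n x
  proof (induction n)
    case (Suc n)
    have "norm (D ((D ^^ n) x)) \<le> (k ^ n * norm x) * k"
      using k(2)[of "(D ^^ n) x"] Suc k(1) by (meson mult_le_cancel_right_pos order_trans)
    then show ?case by (simp add: algebra_simps)
  qed simp
  show ?thesis
  proof (rule that[OF k(1)])
    fix n x t
    show "norm ((t ^ n / fact n) *\<^sub>R (D ^^ n) x) \<le> (\<bar>t\<bar> * k) ^ n /\<^sub>R fact n * norm x"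
      using mult_left_mono[OF *[of n x], of "\<bar>t\<bar> ^ n / fact n"]
      by (simp add: power_abs power_mult_distrib divide_inverse abs_mult mult_ac)
  qed
qed

lemma op_exp_summable: "summable (\<lambda>n. (t ^ n / fact n) *\<^sub>R (D ^^ n) x)"
proof -
  obtain k where k: "k > 0" "\<And>n x t. norm ((t ^ n / fact n) *\<^sub>R (D ^^ n) x) \<le> (\<bar>t\<bar> * k) ^ n /\<^sub>R fact n * norm x"
    using op_exp_bound by blast
  show ?thesis
    by (rule summable_comparison_test'[OF summable_mult2[OF summable_exp_generic[of "\<bar>t\<bar> * k"]] k(2)])
qed

lemma bounded_linear_op_exp: "bounded_linear (op_exp D t)"
proof -
  obtain k where k: "k > 0" "\<And>n x t. norm ((t ^ n / fact n) *\<^sub>R (D ^^ n) x) \<le> (\<bar>t\<bar> * k) ^ n /\<^sub>R fact n * norm x"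
    using op_exp_bound by blast
  show ?thesis
  proof (rule bounded_linear_intro)
    fix x y and r :: real
    show "op_exp D t (x + y) = op_exp D t x + op_exp D t y"
      using suminf_add[OF op_exp_summable op_exp_summable, of t x t y]
      by (simp add: op_exp_def linear_simps[OF bounded_linear_funpow] scaleR_add_right)
    show "op_exp D t (r *\<^sub>R x) = r *\<^sub>R op_exp D t x"
      using suminf_scaleR_right[OF op_exp_summable, of r t x]
      by (simp add: op_exp_def linear_simps[OF bounded_linear_funpow] mult.commute)
    have "norm (op_exp D t x) \<le> (\<Sum>n. (\<bar>t\<bar> * k) ^ n /\<^sub>R fact n * norm x)"
      unfolding op_exp_def
      by (rule norm_suminf_le[OF k(2) summable_mult2[OF summable_exp_generic]])
    also have "\<dots> = exp (\<bar>t\<bar> * k) * norm x"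
      unfolding exp_def by (rule suminf_mult2[symmetric, OF summable_exp_generic])
    finally show "norm (op_exp D t x) \<le> norm x * exp (\<bar>t\<bar> * k)"
      by (simp add: mult.commute)
  qed
qed

lemma op_exp_zero: "op_exp D 0 x = x"
proof -
  have "op_exp D 0 x = (\<Sum>n\<in>{0}. (0 ^ n / fact n) *\<^sub>R (D ^^ n) x)"
    unfolding op_exp_def by (rule suminf_finite) auto
  then show ?thesis by simp
qed

lemma op_exp_commute: "D (op_exp D t x) = op_exp D t (D x)"
  unfolding op_exp_def bounded_linear.suminf[OF D op_exp_summable]
  by (simp add: linear_simps[OF D] funpow_swap1)

lemma op_exp_has_vector_derivative:
  "((\<lambda>t. op_exp D t x) has_vector_derivative D (op_exp D t x)) (at t)"
proof -
  obtain k where k: "k > 0" "\<And>n x t. norm ((t ^ n / fact n) *\<^sub>R (D ^^ n) x) \<le> (\<bar>t\<bar> * k) ^ n /\<^sub>R fact n * norm x"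
    using op_exp_bound by blast
  define R where "R = \<bar>t\<bar> + 1"
  define S where "S = {-R<..<R}"
  define f where "f = (\<lambda>n t. (t ^ n / fact n) *\<^sub>R (D ^^ n) x)"
  \<comment> \<open>Differentiating \<open>t ^ Suc m / fact (Suc m)\<close> gives
    \<open>t ^ m / fact m\<close>. The derived series is thus the exponential series of
    \<open>D x\<close> shifted by one place, with a zero in front.\<close>
  define f' where "f' = (\<lambda>n t h. case n of 0 \<Rightarrow> 0 | Suc m \<Rightarrow> h *\<^sub>R ((t ^ m / fact m) *\<^sub>R (D ^^ m) (D x)))"
  have t: "t \<in> S" "open S" "convex S" by (auto simp: S_def R_def)
  have unif: "uniform_limit S (\<lambda>n t. \<Sum>i<n. (t ^ i / fact i) *\<^sub>R (D ^^ i) (D x))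
      (\<lambda>t. \<Sum>i. (t ^ i / fact i) *\<^sub>R (D ^^ i) (D x)) sequentially"
  proof (rule Weierstrass_m_test)
    show "summable (\<lambda>n. (R * k) ^ n /\<^sub>R fact n * norm (D x))"
      by (rule summable_mult2[OF summable_exp_generic])
    fix n s assume "s \<in> S"
    then have "\<bar>s\<bar> \<le> R" by (auto simp: S_def)
    then have "(\<bar>s\<bar> * k) ^ n /\<^sub>R fact n * norm (D x) \<le> (R * k) ^ n /\<^sub>R fact n * norm (D x)"
      using k(1) by (intro mult_right_mono scaleR_left_mono power_mono) auto
    then show "norm ((s ^ n / fact n) *\<^sub>R (D ^^ n) (D x)) \<le> (R * k) ^ n /\<^sub>R fact n * norm (D x)"
      using k(2) order_trans by blast
  qed
  have "\<exists>g. \<forall>s\<in>S. (\<lambda>n. f n s) sums g s \<and> (g has_derivative (\<lambda>h. h *\<^sub>R op_exp D s (D x))) (at s within S)"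
  proof (rule has_derivative_series[where f' = f' and x = t])
    show "(f n has_derivative f' n s) (at s within S)" for n s
    proof (cases n)
      case 0
      then show ?thesis by (simp add: f_def f'_def)
    next
      case (Suc m)
      have "((\<lambda>s. s ^ Suc m / fact (Suc m)) has_field_derivative (s ^ m / fact m)) (at s within S)"
        using DERIV_cdivide[OF DERIV_pow[of "Suc m" s S], of "fact (Suc m)"]
        by (simp add: divide_simps del: of_nat_Suc)
      then have "((\<lambda>s. (s ^ Suc m / fact (Suc m)) *\<^sub>R (D ^^ Suc m) x) has_vector_derivative
          (s ^ m / fact m) *\<^sub>R (D ^^ Suc m) x) (at s within S)"
        using has_vector_derivative_scaleR[OF _ has_vector_derivative_const] by fastforce
      then show ?thesis
        using Suc by (simp add: f_def f'_def has_vector_derivative_def funpow_swap1)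
    qed
    show "\<forall>\<^sub>F n in sequentially. \<forall>s\<in>S. \<forall>h. norm ((\<Sum>i<n. f' i s h) - h *\<^sub>R op_exp D s (D x)) \<le> e * norm h"
      if "e > 0" for e
    proof -
      have "\<forall>\<^sub>F n in sequentially. \<forall>s\<in>S. dist (\<Sum>i<n. (s ^ i / fact i) *\<^sub>R (D ^^ i) (D x)) (op_exp D s (D x)) < e"
        using uniform_limitD[OF unif that] by (simp add: op_exp_def)
      then obtain N where N: "\<And>n s. n \<ge> N \<Longrightarrow> s \<in> S \<Longrightarrow>
          norm ((\<Sum>i<n. (s ^ i / fact i) *\<^sub>R (D ^^ i) (D x)) - op_exp D s (D x)) < e"
        unfolding eventually_sequentially dist_norm by blast
      have "norm ((\<Sum>i<Suc n. f' i s h) - h *\<^sub>R op_exp D s (D x)) \<le> e * norm h"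
        if "n \<ge> N" "s \<in> S" for n s h
      proof -
        have "(\<Sum>i<Suc n. f' i s h) - h *\<^sub>R op_exp D s (D x)
            = h *\<^sub>R ((\<Sum>i<n. (s ^ i / fact i) *\<^sub>R (D ^^ i) (D x)) - op_exp D s (D x))"
          by (simp only: sum.lessThan_Suc_shift) (simp add: f'_def scaleR_sum_right scaleR_diff_right)
        then show ?thesis
          using mult_left_mono[OF less_imp_le[OF N[OF that]], of "\<bar>h\<bar>"] by (simp add: mult.commute)
      qed
      then show ?thesis
        unfolding eventually_sequentially by (metis Suc_le_D Suc_le_mono)
    qed
    show "(\<lambda>n. f n t) sums op_exp D t x"
      unfolding f_def op_exp_def by (rule summable_sums[OF op_exp_summable])
  qed (use t in auto)
  then obtain g where g: "\<And>s. s \<in> S \<Longrightarrow> (\<lambda>n. f n s) sums g s"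
    and g': "\<And>s. s \<in> S \<Longrightarrow> (g has_derivative (\<lambda>h. h *\<^sub>R op_exp D s (D x))) (at s within S)"
    by blast
  have "g s = op_exp D s x" if "s \<in> S" for s
    using g[OF that] by (simp add: f_def op_exp_def sums_unique)
  then have "((\<lambda>s. op_exp D s x) has_derivative (\<lambda>h. h *\<^sub>R op_exp D t (D x))) (at t)"
    using g'[OF t(1)] t(1,2) by (metis (mono_tags, lifting) at_within_open has_derivative_transform)
  then show ?thesis by (simp add: has_vector_derivative_def op_exp_commute)
qed

text \<open>As functions of \<open>s\<close>, \<open>op_exp D s (op_exp D (- t) x)\<close> and
  \<open>op_exp D (s - t) x\<close> solve the same equation and agree at 0; the claim is the case
  \<open>s = t\<close>.\<close>

lemma op_exp_minus: "op_exp D t (op_exp D (- t) x) = x"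
proof -
  define F where "F = (\<lambda>s. op_exp D s (op_exp D (- t) x) - op_exp D (s - t) x)"
  have "F t = 0"
  proof (rule linear_ode_zero[OF D])
    fix s
    have "((\<lambda>s. op_exp D (s - t) x) has_vector_derivative D (op_exp D (s - t) x)) (at s)"
      using vector_diff_chain_at[of "\<lambda>s. s - t" 1 s "\<lambda>r. op_exp D r x", OF _ op_exp_has_vector_derivative]
      using has_vector_derivative_diff[OF has_vector_derivative_id has_vector_derivative_const] by (simp add: o_def id_def)
    then show "(F has_vector_derivative D (F s)) (at s)"
      unfolding F_def by (auto intro!: derivative_eq_intros op_exp_has_vector_derivative simp: linear_simps[OF D])
  qed (simp add: F_def op_exp_zero)
  then show ?thesis by (simp add: F_def op_exp_zero)
qed

lemma op_exp_kernel:
  assumes "D x = 0"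
  shows "op_exp D t x = x"
proof -
  have "op_exp D t x - x = 0"
  proof (rule linear_ode_zero[OF D])
    show "((\<lambda>t. op_exp D t x - x) has_vector_derivative D (op_exp D s x - x)) (at s)" for s
      using assms by (auto intro!: derivative_eq_intros op_exp_has_vector_derivative simp: linear_simps[OF D])
  qed (simp add: op_exp_zero)
  then show ?thesis by simp
qed

text \<open>By the Leibniz rule both sides solve the equation F' = D F with initial value
  \<open>B x y\<close>. For the Jordan product this turns derivations into one-parameter groups of
  automorphisms.\<close>

lemma op_exp_derivation:
  assumes B: "bounded_bilinear B"
    and deriv: "\<And>x y. D (B x y) = B (D x) y + B x (D y)"
  shows "op_exp D t (B x y) = B (op_exp D t x) (op_exp D t y)"
proof -
  have "op_exp D t (B x y) - B (op_exp D t x) (op_exp D t y) = 0"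
  proof (rule linear_ode_zero[OF D])
    show "((\<lambda>t. op_exp D t (B x y) - B (op_exp D t x) (op_exp D t y)) has_vector_derivative
        D (op_exp D s (B x y) - B (op_exp D s x) (op_exp D s y))) (at s)" for s
      by (rule has_vector_derivative_eq_rhs, rule has_vector_derivative_diff, rule op_exp_has_vector_derivative,
          rule bounded_bilinear.has_vector_derivative[OF B])
        (auto intro: op_exp_has_vector_derivative simp: linear_simps[OF D] deriv)
  qed (simp add: op_exp_zero)
  then show ?thesis by simp
qed

end

section \<open>Two real inequalities\<close>

text \<open>Log-convexity makes successive ratios nondecreasing. A first ratio above
  \<open>r\<close> would force geometric growth faster than \<open>r ^ n\<close>, so the constant
  \<open>C\<close> disappears from the conclusion.\<close>

lemma log_convex_growth:
  fixes \<alpha> :: "nat \<Rightarrow> real"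
  assumes nonneg: "\<And>n. \<alpha> n \<ge> 0"
    and conv: "\<And>n. (\<alpha> (Suc n))\<^sup>2 \<le> \<alpha> n * \<alpha> (Suc (Suc n))"
    and bound: "\<And>n. \<alpha> n \<le> C * r ^ n"
    and r: "r \<ge> 0"
  shows "\<alpha> 1 \<le> r * \<alpha> 0"
proof (rule ccontr)
  assume "\<not> \<alpha> 1 \<le> r * \<alpha> 0"
  then have less: "r * \<alpha> 0 < \<alpha> 1" by simp
  have a1: "\<alpha> 1 > 0" using less r nonneg[of 0] by (smt (verit) mult_nonneg_nonneg)
  have a0: "\<alpha> 0 > 0"
    using conv[of 0] a1 nonneg[of 0] by (cases "\<alpha> 0 = 0") auto
  define \<beta> where "\<beta> = \<alpha> 1 / \<alpha> 0"
  have \<beta>: "\<beta> > r" "\<beta> > 0" using less a0 a1 r by (auto simp: \<beta>_def field_simps)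
  have step: "\<alpha> n > 0 \<and> \<alpha> (Suc n) \<ge> \<beta> * \<alpha> n" for n
  proof (induction n)
    case 0
    then show ?case using a0 by (simp add: \<beta>_def)
  next
    case (Suc n)
    then have pos: "\<alpha> n > 0" "\<alpha> (Suc n) > 0"
      using \<beta>(2) mult_pos_pos[of \<beta> "\<alpha> n"] by linarith+
    have "\<beta> * \<alpha> (Suc n) * \<alpha> n \<le> \<alpha> (Suc n) * \<alpha> (Suc n)"
      using Suc pos mult_right_mono[of "\<beta> * \<alpha> n" "\<alpha> (Suc n)" "\<alpha> (Suc n)"] by (simp add: mult_ac)
    also have "\<dots> \<le> \<alpha> (Suc (Suc n)) * \<alpha> n"
      using conv[of n] by (simp add: power2_eq_square mult_ac)
    finally show ?case using pos by simp
  qed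
  have low: "\<beta> ^ n * \<alpha> 0 \<le> \<alpha> n" for n
  proof (induction n)
    case (Suc n)
    then have "\<beta> * (\<beta> ^ n * \<alpha> 0) \<le> \<beta> * \<alpha> n" using \<beta>(2) by simp
    also have "\<dots> \<le> \<alpha> (Suc n)" using step by blast
    finally show ?case by (simp add: mult_ac)
  qed simp
  have "\<alpha> 0 \<le> C * (r / \<beta>) ^ n" for n
    using order_trans[OF low bound, of n] \<beta>(2) by (simp add: field_simps)
  moreover have "(\<lambda>n. C * (r / \<beta>) ^ n) \<longlonglongrightarrow> C * 0"
    using \<beta> r by (intro tendsto_mult tendsto_const LIMSEQ_realpow_zero) auto
  ultimately have "\<alpha> 0 \<le> 0"
    by (metis LIMSEQ_le_const mult_zero_right)
  then show False using a0 by simp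
qed

lemma quadratic_form_Cauchy_Schwarz:
  fixes p q r :: real
  assumes form: "\<And>t. p + 2 * t * q + t\<^sup>2 * r \<ge> 0" and r: "r \<ge> 0"
  shows "q\<^sup>2 \<le> p * r"
proof (cases "r = 0")
  case True
  have "q = 0"
  proof (rule ccontr)
    assume "q \<noteq> 0"
    \<comment> \<open>At this argument the form takes the value -1.\<close>
    then show False using form[of "- (p + 1) / (2 * q)"] True by (simp add: field_simps)
  qed
  then show ?thesis using True by simp
next
  case False
  then have "r > 0" using r by simp
  then show ?thesis using form[of "- q / r"] by (simp add: field_simps power2_eq_square)
qed

section \<open>Jordan algebras and their states\<close>

text \<open>Function types carry no vector space structure in the library, so \<open>extreme_point_of\<close> does not
  apply to sets of functionals.\<close>

definition extreme_fun :: "('f \<Rightarrow> real) set \<Rightarrow> ('f \<Rightarrow> real) \<Rightarrow> bool" where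
  "extreme_fun S w \<longleftrightarrow> w \<in> S \<and>
     (\<forall>p\<in>S. \<forall>q\<in>S. \<forall>t. 0 < t \<and> t < 1 \<and> w = (\<lambda>x. t * p x + (1 - t) * q x) \<longrightarrow> p = q)"

lemma extreme_funD:
  assumes "extreme_fun S w" "p \<in> S" "q \<in> S" "0 < t" "t < 1"
    and "\<And>x. w x = t * p x + (1 - t) * q x"
  shows "p = q"
  using assms(1-5) ext[of w "\<lambda>x. t * p x + (1 - t) * q x", OF assms(6)]
  unfolding extreme_fun_def by blast

locale JB =
  fixes jp :: "'a::banach \<Rightarrow> 'a \<Rightarrow> 'a" (infixl "\<odot>" 70) and u :: 'a
  assumes JB: "JB_algebra jp u"
begin

lemma comm: "a \<odot> b = b \<odot> a"
  and jordan: "((a \<odot> a) \<odot> b) \<odot> a = (a \<odot> a) \<odot> (b \<odot> a)"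
  and unit_left [simp]: "u \<odot> a = a"
  and norm_prod: "norm (a \<odot> b) \<le> norm a * norm b"
  and norm_square: "norm (a \<odot> a) = (norm a)\<^sup>2"
  and norm_sum_squares: "norm (a \<odot> a) \<le> norm (a \<odot> a + b \<odot> b)"
  using JB unfolding JB_algebra_def by blast+

lemma unit_right [simp]: "a \<odot> u = a"
  using comm unit_left by metis

sublocale bounded_bilinear jp
proof (unfold_locales)
  have bl: "linear (\<lambda>x. a \<odot> x)" "linear (\<lambda>x. x \<odot> a)" for a
    using JB unfolding JB_algebra_def bilinear_def by blast+
  show "(a + a') \<odot> b = a \<odot> b + a' \<odot> b" "b \<odot> (a + a') = b \<odot> a + b \<odot> a'"
    "(r *\<^sub>R a) \<odot> b = r *\<^sub>R (a \<odot> b)" "a \<odot> (r *\<^sub>R b) = r *\<^sub>R (a \<odot> b)" for a a' b r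
    using linear_add[OF bl(1)] linear_add[OF bl(2)] linear_scale[OF bl(1)] linear_scale[OF bl(2)]
    by blast+
  show "\<exists>K. \<forall>a b. norm (a \<odot> b) \<le> norm a * norm b * K"
    using norm_prod by (intro exI[of _ 1]) simp
qed

lemmas bilin = add_left add_right diff_left diff_right scaleR_left scaleR_right

lemma norm_unit: "norm u \<le> 1"
proof -
  have "norm u = norm u * norm u" using norm_square[of u] by (simp add: power2_eq_square)
  then show ?thesis by (cases "norm u = 0") simp_all
qed

section \<open>Inner derivations\<close>

lemma jordan_linearized:
  "(a \<odot> b) \<odot> (c \<odot> d) + (b \<odot> c) \<odot> (a \<odot> d) + (c \<odot> a) \<odot> (b \<odot> d)
   = c \<odot> ((a \<odot> b) \<odot> d) + a \<odot> ((b \<odot> c) \<odot> d) + b \<odot> ((c \<odot> a) \<odot> d)"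
    (is "?L = ?R")
proof -
  define P where "P x = (x \<odot> x) \<odot> (x \<odot> d) - x \<odot> ((x \<odot> x) \<odot> d)" for x
  have P: "P x = 0" for x
    unfolding P_def using jordan[of x d] comm by (metis diff_self)
  \<comment> \<open>\<open>P\<close> is cubic in its argument, so inclusion-exclusion isolates the
    part linear in each of \<open>a\<close>, \<open>b\<close>, \<open>c\<close>; by commutativity
    each term of it occurs twice.\<close>
  have "2 *\<^sub>R (?L - ?R) = P (a + b + c) - P (a + b) - P (b + c) - P (a + c) + P a + P b + P c"
    unfolding P_def by (simp add: bilin scaleR_2 algebra_simps comm)
  then show ?thesis by (simp add: P)
qed

definition inner_der :: "'a \<Rightarrow> 'a \<Rightarrow> 'a \<Rightarrow> 'a" where
  "inner_der a b x = a \<odot> (b \<odot> x) - b \<odot> (a \<odot> x)"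

text \<open>The left-hand side of \<open>jordan_linearized\<close> is symmetric in all four arguments, so the
  right-hand sides for permuted arguments agree.\<close>

lemma inner_der_derivation: "inner_der a b (c \<odot> d) = inner_der a b c \<odot> d + c \<odot> inner_der a b d"
proof -
  have "c \<odot> ((a \<odot> d) \<odot> b) + a \<odot> ((d \<odot> c) \<odot> b) + d \<odot> ((c \<odot> a) \<odot> b)
      = c \<odot> ((d \<odot> b) \<odot> a) + d \<odot> ((b \<odot> c) \<odot> a) + b \<odot> ((c \<odot> d) \<odot> a)"
    using jordan_linearized[of a d c b] jordan_linearized[of d b c a] by (simp add: comm add_ac)
  then show ?thesis
    unfolding inner_der_def by (simp add: bilin algebra_simps comm)
qed

lemma bounded_linear_inner_der: "bounded_linear (inner_der a b)"
  unfolding inner_der_def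
  by (intro bounded_linear_sub bounded_linear_compose[OF bounded_linear_right bounded_linear_right])

text \<open>\<open>(u - y)\<^sup>2 = u - x\<close> is the fixed point equation \<open>y = (x + y\<^sup>2) / 2\<close>; the map is a contraction
  because \<open>y\<^sup>2 - z\<^sup>2 = (y + z)(y - z)\<close> needs commutativity only.\<close>

lemma square_root_near_unit:
  assumes x: "norm x < 1"
  obtains y where "y \<odot> y = u - x"
proof -
  \<comment> \<open>\<open>r\<close> is the smaller root of \<open>norm x = 2 * r - r * r\<close>:
    the bound (norm x + r * r) / 2 on the image of the ball is then exactly \<open>r\<close>, and
    \<open>r\<close> is also the contraction constant.\<close>
  define r where "r = 1 - sqrt (1 - norm x)"
  have "1 - r = sqrt (1 - norm x)" by (simp add: r_def)
  then have "(1 - r)\<^sup>2 = 1 - norm x" using x by simp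
  then have nx: "norm x = 2 * r - r * r" by (simp add: power2_eq_square algebra_simps)
  have r: "0 \<le> r" "r < 1" using x by (auto simp: r_def)
  define f where "f y = (1/2) *\<^sub>R (x + y \<odot> y)" for y
  have "\<exists>!y. y \<in> cball 0 r \<and> f y = y"
  proof (rule Banach_fix[OF _ _ r])
    show "complete (cball (0::'a) r)" by (simp add: complete_eq_closed)
    show "cball (0::'a) r \<noteq> {}" using r by simp
    show "f ` cball 0 r \<subseteq> cball 0 r"
    proof (clarsimp simp: f_def)
      fix y :: 'a assume y: "norm y \<le> r"
      have "norm (x + y \<odot> y) \<le> norm x + r * r"
        using norm_triangle_ineq[of x "y \<odot> y"] norm_prod[of y y] mult_mono[OF y y] r by simp
      then show "norm (x + y \<odot> y) \<le> r * 2" using nx by simp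
    qed
    show "dist (f y) (f z) \<le> r * dist y z" if "y \<in> cball 0 r" "z \<in> cball 0 r" for y z
    proof -
      have "f y - f z = (1/2) *\<^sub>R ((y + z) \<odot> (y - z))"
        by (simp add: f_def bilin algebra_simps comm[of z y])
      then have "norm (f y - f z) = 1/2 * norm ((y + z) \<odot> (y - z))" by simp
      also have "\<dots> \<le> 1/2 * (norm (y + z) * norm (y - z))"
        using norm_prod by (intro mult_left_mono) auto
      also have "\<dots> \<le> 1/2 * ((2 * r) * norm (y - z))"
        using that norm_triangle_ineq[of y z] by (intro mult_left_mono mult_right_mono) auto
      finally show ?thesis by (simp add: dist_norm)
    qed
  qed
  then obtain y where "f y = y" by blast
  then have "2 *\<^sub>R f y = 2 *\<^sub>R y" by simp
  then have "x + y \<odot> y = 2 *\<^sub>R y" by (simp add: f_def)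
  then have "(u - y) \<odot> (u - y) = u - x" by (simp add: bilin algebra_simps scaleR_2)
  then show ?thesis using that by blast
qed

section \<open>Positive functionals and states\<close>

definition positive :: "('a \<Rightarrow> real) \<Rightarrow> bool" where
  "positive f \<longleftrightarrow> linear f \<and> (\<forall>x. f (x \<odot> x) \<ge> 0)"

text \<open>If \<open>c\<close> exceeds \<open>norm y\<close>, then
  \<open>u - (1 / c) *\<^sub>R y\<close> is a square, hence \<open>f y\<close> is at most
  \<open>c * f u\<close>. Let \<open>c\<close> decrease to \<open>norm y\<close> and apply this to
  \<open>x\<close> and \<open>- x\<close>.\<close>

lemma positive_bound:
  assumes f: "positive f"
  shows "\<bar>f x\<bar> \<le> f u * norm x"
proof -
  have lin: "linear f" and sq: "f (x \<odot> x) \<ge> 0" for x using f by (auto simp: positive_def)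
  have fu: "f u \<ge> 0" using sq[of u] by simp
  have le: "f y \<le> c * f u" if "norm y < c" for y c
  proof -
    have c: "c > 0" using that norm_ge_zero le_less_trans by blast
    then have "norm ((1 / c) *\<^sub>R y) < 1" using that by (simp add: field_simps)
    then obtain z where "z \<odot> z = u - (1 / c) *\<^sub>R y" using square_root_near_unit by blast
    then have "f u - (1 / c) * f y \<ge> 0"
      using sq[of z] by (simp add: linear_diff[OF lin] linear_scale[OF lin])
    then show ?thesis using c by (simp add: field_simps)
  qed
  have "f y \<le> norm y * f u" for y
  proof (rule field_le_epsilon)
    fix e :: real assume e: "e > 0"
    \<comment> \<open>The summand 1 keeps the quotient defined when \<open>f u = 0\<close>.\<close>
    have "f y \<le> (norm y + e / (f u + 1)) * f u" using le[of y "norm y + e / (f u + 1)"] e fu by simp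
    also have "\<dots> \<le> norm y * f u + e" using e fu by (simp add: field_simps)
    finally show "f y \<le> norm y * f u + e" .
  qed
  from this[of x] this[of "- x"] show ?thesis
    by (simp add: linear_neg[OF lin] mult.commute abs_le_iff)
qed

lemma positive_bounded_linear: "positive f \<Longrightarrow> bounded_linear f"
  using positive_bound[of f]
  by (intro bounded_linear_intro[where K = "f u"])
    (auto simp: positive_def linear_add linear_scale mult.commute)

lemma state_space_eq: "state_space jp u = {f. positive f \<and> f u = 1}"
  using positive_bounded_linear by (auto simp: state_space_def positive_def linear_continuous_on)

lemma positive_Cauchy_Schwarz:
  assumes "positive f"
  shows "(f (x \<odot> y))\<^sup>2 \<le> f (x \<odot> x) * f (y \<odot> y)"
proof (rule quadratic_form_Cauchy_Schwarz)
  show "0 \<le> f (y \<odot> y)" using assms by (simp add: positive_def)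
  fix t
  have lin: "linear f" using assms by (simp add: positive_def)
  have "0 \<le> f ((x + t *\<^sub>R y) \<odot> (x + t *\<^sub>R y))" using assms by (simp add: positive_def)
  also have "\<dots> = f (x \<odot> x) + 2 * t * f (x \<odot> y) + t\<^sup>2 * f (y \<odot> y)"
    by (simp add: bilin comm[of y x] linear_add[OF lin] linear_scale[OF lin] power2_eq_square algebra_simps)
  finally show "0 \<le> f (x \<odot> x) + 2 * t * f (x \<odot> y) + t\<^sup>2 * f (y \<odot> y)" .
qed

section \<open>Tracial functionals\<close>

text \<open>The functionals vanishing on the range of every \<open>inner_der a b\<close>.\<close>

definition tracial :: "('a \<Rightarrow> real) \<Rightarrow> bool" where
  "tracial f \<longleftrightarrow> (\<forall>a b c. f (a \<odot> (b \<odot> c)) = f (b \<odot> (a \<odot> c)))"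

text \<open>Multiplication by \<open>x\<close> is symmetric for the semidefinite form
  \<open>f (a \<odot> b)\<close>. Its iterates on \<open>c\<close> have log-convex squared
  seminorms, whose growth rate is controlled by the norm, and \<open>log_convex_growth\<close>
  yields the bound without an extra constant.\<close>

lemma tracial_square_bound:
  assumes f: "positive f" and tr: "tracial f"
  shows "f ((x \<odot> c) \<odot> (x \<odot> c)) \<le> (norm x)\<^sup>2 * f (c \<odot> c)"
proof -
  define L where "L n = (jp x ^^ n) c" for n
  define \<alpha> where "\<alpha> n = f (L n \<odot> L n)" for n
  have [simp]: "L (Suc n) = x \<odot> L n" for n by (simp add: L_def)
  have adj: "f ((x \<odot> y) \<odot> z) = f (y \<odot> (x \<odot> z))" for y z
    using tr unfolding tracial_def by (metis comm)
  have norm_L: "norm (L n) \<le> norm x ^ n * norm c" for n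
  proof (induction n)
    case (Suc n)
    then show ?case
      using norm_prod[of x "L n"] mult_left_mono[OF Suc, of "norm x"] by (simp add: mult_ac)
  qed (simp add: L_def)
  have fu: "f u \<ge> 0" using f unfolding positive_def by (metis unit_left)
  have "\<alpha> 1 \<le> (norm x)\<^sup>2 * \<alpha> 0"
  proof (rule log_convex_growth)
    show "0 \<le> \<alpha> n" for n using f by (simp add: \<alpha>_def positive_def)
    \<comment> \<open>Symmetry moves one factor \<open>x\<close> across the form, so
      \<open>f (L n \<odot> L (Suc (Suc n)))\<close> equals \<open>\<alpha> (Suc n)\<close>.\<close>
    show "(\<alpha> (Suc n))\<^sup>2 \<le> \<alpha> n * \<alpha> (Suc (Suc n))" for n
      using positive_Cauchy_Schwarz[OF f, of "L n" "L (Suc (Suc n))"] by (simp add: \<alpha>_def adj)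
    show "\<alpha> n \<le> (f u * (norm c)\<^sup>2) * ((norm x)\<^sup>2) ^ n" for n
    proof -
      have "\<alpha> n \<le> f u * (norm (L n))\<^sup>2"
        using positive_bound[OF f, of "L n \<odot> L n"] by (simp add: \<alpha>_def norm_square)
      also have "\<dots> \<le> f u * (norm x ^ n * norm c)\<^sup>2"
        using fu norm_L by (intro mult_left_mono power_mono) auto
      also have "\<dots> = (f u * (norm c)\<^sup>2) * ((norm x)\<^sup>2) ^ n"
        by (simp add: power_mult_distrib power_mult[symmetric] mult_ac)
      finally show ?thesis .
    qed
  qed simp
  then show ?thesis by (simp add: \<alpha>_def) (simp add: L_def)
qed

lemma tracial_squares_nonneg:
  assumes f: "positive f" and tr: "tracial f"
  shows "f ((b \<odot> b) \<odot> (c \<odot> c)) \<ge> 0"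
proof -
  have lin: "linear f" and sq: "f (c \<odot> c) \<ge> 0" using f by (auto simp: positive_def)
  define k where "k = 1 / (norm b + 1)"
  define d where "d = k *\<^sub>R b"
  have k: "k > 0" by (simp add: k_def add_nonneg_pos)
  have "norm d < 1"
    using add_nonneg_pos[OF norm_ge_zero[of b] zero_less_one]
    by (simp add: d_def k_def divide_simps)
  then have "norm (d \<odot> d) < 1" by (simp add: norm_square power_less_one_iff)
  then obtain y where y: "y \<odot> y = u - d \<odot> d" using square_root_near_unit by blast
  define x where "x = u - d \<odot> d"
  \<comment> \<open>Here \<open>x\<close> is the square of \<open>y\<close>, and
    \<open>y \<odot> y + d \<odot> d = u\<close>, so the norm axiom for sums of squares
    applies.\<close>
  have "norm x \<le> 1" using norm_sum_squares[of y d] norm_unit by (simp add: y x_def)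
  have "(f ((x \<odot> c) \<odot> c))\<^sup>2 \<le> f ((x \<odot> c) \<odot> (x \<odot> c)) * f (c \<odot> c)"
    by (rule positive_Cauchy_Schwarz[OF f])
  also have "\<dots> \<le> ((norm x)\<^sup>2 * f (c \<odot> c)) * f (c \<odot> c)"
    using tracial_square_bound[OF f tr] sq by (intro mult_right_mono)
  also have "\<dots> \<le> (1 * f (c \<odot> c)) * f (c \<odot> c)"
    using \<open>norm x \<le> 1\<close> sq by (intro mult_right_mono) (auto simp: power_le_one)
  finally have "f ((x \<odot> c) \<odot> c) \<le> f (c \<odot> c)"
    using sq by (simp add: power2_eq_square[symmetric] power2_le_iff_abs_le)
  moreover have "f ((x \<odot> c) \<odot> c) = f (c \<odot> c) - f (((d \<odot> d) \<odot> c) \<odot> c)"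
    by (simp add: x_def bilin linear_diff[OF lin])
  \<comment> \<open>Traciality supplies the associativity that the product lacks.\<close>
  moreover have "f (((d \<odot> d) \<odot> c) \<odot> c) = f ((d \<odot> d) \<odot> (c \<odot> c))"
    using tr unfolding tracial_def by (metis comm)
  moreover have "f ((d \<odot> d) \<odot> (c \<odot> c)) = (k * k) * f ((b \<odot> b) \<odot> (c \<odot> c))"
    by (simp add: d_def bilin linear_scale[OF lin])
  ultimately have "0 \<le> (k * k) * f ((b \<odot> b) \<odot> (c \<odot> c))" by simp
  then show ?thesis using mult_pos_pos[OF k k] by (simp only: zero_le_mult_iff) linarith
qed

section \<open>Pure states\<close>

lemma pure_state_split:
  assumes w: "extreme_fun (state_space jp u) w"
    and a: "\<And>y. w (a \<odot> (y \<odot> y)) \<ge> 0" and a': "\<And>y. w ((u - a) \<odot> (y \<odot> y)) \<ge> 0"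
  shows "w (a \<odot> y) = w a * w y"
proof -
  have lin: "linear w" and wu: "w u = 1"
    using w by (auto simp: extreme_fun_def state_space_eq positive_def)
  \<comment> \<open>The state \<open>w\<close> is the sum of the positive functionals
    \<open>p\<close> and \<open>q\<close>. After normalization this is a convex combination with
    weights \<open>w a\<close> and \<open>1 - w a\<close>, so purity makes \<open>p\<close>
    proportional to \<open>w\<close>.\<close>
  define p where "p y = w (a \<odot> y)" for y
  define q where "q y = w ((u - a) \<odot> y)" for y
  have pos: "positive p" "positive q"
    using a a' by (auto simp: positive_def p_def q_def bilin linear_iff linear_add[OF lin]
        linear_diff[OF lin] linear_scale[OF lin] algebra_simps)
  have pq: "w y = p y + q y" for y
    by (simp add: p_def q_def bilin linear_diff[OF lin])
  have pu: "p u = w a" "q u = 1 - w a" by (simp_all add: p_def q_def linear_diff[OF lin] wu)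
  have "0 \<le> p u" "0 \<le> q u" using pos unfolding positive_def by (metis unit_left)+
  then consider "w a = 0" | "w a = 1" | "0 < w a" "w a < 1" using pu by linarith
  then show ?thesis
  proof cases
    \<comment> \<open>At an endpoint weight one summand vanishes at \<open>u\<close>, hence
      everywhere by \<open>positive_bound\<close>.\<close>
    case 1
    then show ?thesis using positive_bound[OF pos(1), of y] pu by (simp add: p_def)
  next
    case 2
    then show ?thesis using positive_bound[OF pos(2), of y] pu pq[of y] by (simp add: p_def)
  next
    case 3
    have pos_scale: "positive (\<lambda>y. f y / r)" if "positive f" "r > 0" for f r
      using that by (auto simp: positive_def linear_iff add_divide_distrib)
    have "(\<lambda>y. p y / w a) = (\<lambda>y. q y / (1 - w a))"
    proof (rule extreme_funD[OF w])
      show "(\<lambda>y. p y / w a) \<in> state_space jp u" "(\<lambda>y. q y / (1 - w a)) \<in> state_space jp u"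
        using 3 pu pos pos_scale by (auto simp: state_space_eq)
      show "w y = w a * (p y / w a) + (1 - w a) * (q y / (1 - w a))" for y
        using 3 pq by simp
    qed (use 3 in auto)
    then have "p y / w a = q y / (1 - w a)" by meson
    then have "p y * (1 - w a) = (w y - p y) * w a" using 3 pq[of y] by (simp add: field_simps)
    then show ?thesis by (simp add: p_def algebra_simps)
  qed
qed

text \<open>For \<open>norm v < 1\<close> both (u - v) / 2 and (u + v) / 2 are halves of squares.
  They add up to \<open>u\<close>, so \<open>pure_state_split\<close> applies to the first;
  linearity carries the result to \<open>v\<close> and then to its multiple
  \<open>x\<close>.\<close>

lemma pure_tracial_multiplicative:
  assumes w: "extreme_fun (state_space jp u) w" and tr: "tracial w"
  shows "w (x \<odot> y) = w x * w y"
proof -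
  have f: "positive w" and lin: "linear w" and wu: "w u = 1"
    using w by (auto simp: extreme_fun_def state_space_eq positive_def)
  define k where "k = 1 / (norm x + 1)"
  define v where "v = k *\<^sub>R x"
  have k: "k > 0" by (simp add: k_def add_nonneg_pos)
  have "norm v < 1"
    using add_nonneg_pos[OF norm_ge_zero[of x] zero_less_one]
    by (simp add: v_def k_def divide_simps)
  then have "norm v < 1" "norm (- v) < 1" by simp_all
  then obtain d e where de: "d \<odot> d = u - v" "e \<odot> e = u - (- v)"
    using square_root_near_unit by metis
  have "w (((1/2) *\<^sub>R (u - v)) \<odot> y) = w ((1/2) *\<^sub>R (u - v)) * w y"
  proof (rule pure_state_split[OF w])
    fix z
    show "0 \<le> w (((1/2) *\<^sub>R (u - v)) \<odot> (z \<odot> z))"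
      using tracial_squares_nonneg[OF f tr, of d z] by (simp add: de bilin linear_scale[OF lin])
    have "u - (1/2) *\<^sub>R (u - v) = (1/2) *\<^sub>R (e \<odot> e)"
      unfolding de by (simp add: algebra_simps flip: scaleR_left_distrib)
    then show "0 \<le> w ((u - (1/2) *\<^sub>R (u - v)) \<odot> (z \<odot> z))"
      using tracial_squares_nonneg[OF f tr, of e z] by (simp only: scaleR_left linear_scale[OF lin]) simp
  qed
  then have "w (v \<odot> y) = w v * w y"
    by (simp add: bilin linear_scale[OF lin] linear_diff[OF lin] wu algebra_simps)
  then show ?thesis using k by (simp add: v_def bilin linear_scale[OF lin])
qed

lemma pure_state_orbit:
  assumes w: "extreme_fun (state_space jp u) w" and tr: "\<not> tracial w"
  obtains g :: "real \<Rightarrow> 'a \<Rightarrow> real" where "inj g" "\<And>r. extreme_fun (state_space jp u) (g r)"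
proof -
  obtain a b c where "w (a \<odot> (b \<odot> c)) \<noteq> w (b \<odot> (a \<odot> c))" using tr by (auto simp: tracial_def)
  moreover have lin: "linear w" and wu: "w u = 1" and bl: "bounded_linear w"
    using w positive_bounded_linear[of w] by (auto simp: extreme_fun_def state_space_eq positive_def)
  define D where "D = inner_der a b"
  ultimately have Dc: "w (D c) \<noteq> 0" by (simp add: D_def inner_der_def linear_diff[OF lin])
  have D: "bounded_linear D" unfolding D_def by (rule bounded_linear_inner_der)
  have Du: "D u = 0" by (simp add: D_def inner_der_def comm)
  note E_linear = bounded_linear.linear[OF bounded_linear_op_exp[OF D]]
  have E_prod: "op_exp D t (x \<odot> y) = op_exp D t x \<odot> op_exp D t y" for t x y
    by (rule op_exp_derivation[OF D bounded_bilinear_axioms]) (simp add: D_def inner_der_derivation)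
  define g where "g t = (\<lambda>x. w (op_exp D t x))" for t
  have state: "(\<lambda>x. f (op_exp D t x)) \<in> state_space jp u" if "f \<in> state_space jp u" for f t
    using that linear_compose[OF E_linear, of f t]
    by (auto simp: state_space_eq positive_def E_prod op_exp_kernel[OF D Du] o_def)
  have extr: "extreme_fun (state_space jp u) (g t)" for t
    unfolding extreme_fun_def
  proof (intro conjI ballI allI impI)
    show "g t \<in> state_space jp u"
      using w state by (simp add: g_def extreme_fun_def)
    fix p q s
    assume p: "p \<in> state_space jp u" and q: "q \<in> state_space jp u"
      and s: "0 < s \<and> s < 1 \<and> g t = (\<lambda>x. s * p x + (1 - s) * q x)"
    \<comment> \<open>Composing with the inverse automorphism turns a decomposition of
      \<open>g t\<close> into one of \<open>w\<close>.\<close>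
    have "w x = s * p (op_exp D (- t) x) + (1 - s) * q (op_exp D (- t) x)" for x
      using fun_cong[OF conjunct2[OF conjunct2[OF s]], of "op_exp D (- t) x"]
      by (simp add: g_def op_exp_minus[OF D])
    then have "(\<lambda>x. p (op_exp D (- t) x)) = (\<lambda>x. q (op_exp D (- t) x))"
      using extreme_funD[OF w state[OF p] state[OF q], of s] s by blast
    then have "p (op_exp D (- t) (op_exp D t x)) = q (op_exp D (- t) (op_exp D t x))" for x
      by meson
    then show "p = q" using op_exp_minus[OF D, of "- t"] by auto
  qed
  have deriv: "((\<lambda>t. g t c) has_vector_derivative w (D (op_exp D t c))) (at t)" for t
    unfolding g_def
    by (rule bounded_linear.has_vector_derivative[OF bl op_exp_has_vector_derivative[OF D]])
  \<comment> \<open>The derivative at 0 is \<open>w (D c)\<close>, which is nonzero.\<close>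
  have "\<exists>t. g t c \<noteq> g 0 c"
  proof (rule ccontr)
    assume "\<not> ?thesis"
    then have "(\<lambda>t. g t c) = (\<lambda>t. g 0 c)" by auto
    then have "((\<lambda>t. g 0 c) has_vector_derivative w (D c)) (at 0)"
      using deriv[of 0] by (simp add: op_exp_zero[OF D])
    then show False
      using Dc has_vector_derivative_const vector_derivative_unique_at by blast
  qed
  then obtain t1 where t1: "g t1 c \<noteq> g 0 c" by blast
  define lo hi where "lo = min (g 0 c) (g t1 c)" and "hi = max (g 0 c) (g t1 c)"
  have lohi: "lo < hi" using t1 by (auto simp: lo_def hi_def)
  have "connected (range (\<lambda>t. g t c))"
    using deriv has_vector_derivative_continuous continuous_at_imp_continuous_on
    by (intro connected_continuous_image) blast+
  moreover have "lo \<in> range (\<lambda>t. g t c)" "hi \<in> range (\<lambda>t. g t c)"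
    by (auto simp: lo_def hi_def min_def max_def)
  ultimately have image: "{lo..hi} \<subseteq> range (\<lambda>t. g t c)"
    by (rule connected_contains_Icc)
  \<comment> \<open>An injection of the whole line into the interval of attained values.\<close>
  define \<sigma> where "\<sigma> r = lo + (hi - lo) * (arctan r / pi + 1 / 2)" for r
  have \<sigma>: "\<sigma> r \<in> {lo..hi}" for r
  proof -
    have "0 \<le> arctan r / pi + 1 / 2" "arctan r / pi + 1 / 2 \<le> 1"
      using arctan_bounded[of r] by (auto simp: field_simps)
    then have "0 \<le> (hi - lo) * (arctan r / pi + 1 / 2)"
      "(hi - lo) * (arctan r / pi + 1 / 2) \<le> hi - lo"
      using lohi by (auto intro!: mult_nonneg_nonneg mult_left_le simp del: zero_le_divide_iff)
    then show ?thesis by (simp only: \<sigma>_def atLeastAtMost_iff) linarith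
  qed
  have "\<exists>t. g t c = \<sigma> r" for r using subsetD[OF image \<sigma>] by (metis rangeE)
  \<comment> \<open>\<open>\<tau>\<close> chooses a time at which the value
    \<open>\<sigma> r\<close> is attained; different \<open>r\<close> give functionals that differ
    at \<open>c\<close>.\<close>
  then obtain \<tau> where \<tau>: "\<And>r. g (\<tau> r) c = \<sigma> r" by metis
  have "inj \<sigma>" using lohi by (intro injI) (simp add: \<sigma>_def arctan_eq_iff)
  then have "inj (\<lambda>r. g (\<tau> r))" using \<tau> by (metis (no_types, lifting) inj_def)
  then show ?thesis using that extr by blast
qed

end

section \<open>Extreme points of state spaces that are not simplices\<close>

theorem theorem1:
  fixes jp :: "'a::banach \<Rightarrow> 'a \<Rightarrow> 'a" and u :: 'a
    and K :: "'b::real_vector set" and \<phi> :: "('a \<Rightarrow> real) \<Rightarrow> 'b"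
  assumes "JB_algebra jp u"
    and "convex K"
    and "affine_iso_fun (state_space jp u) K \<phi>"
    and "\<not> is_simplex K"
  shows "\<exists>g :: real \<Rightarrow> 'b. inj g \<and> range g \<subseteq> {x. x extreme_point_of K}"
proof -
  interpret JB jp u by unfold_locales fact
  let ?S = "state_space jp u"
  have bij: "bij_betw \<phi> ?S K"
    and aff: "\<And>p q t. p \<in> ?S \<Longrightarrow> q \<in> ?S \<Longrightarrow> 0 \<le> t \<Longrightarrow> t \<le> 1 \<Longrightarrow>
      \<phi> (\<lambda>x. t * p x + (1 - t) * q x) = t *\<^sub>R \<phi> p + (1 - t) *\<^sub>R \<phi> q"
    using assms(3) unfolding affine_iso_fun_def by blast+
  have inj: "inj_on \<phi> ?S" and onto: "\<phi> ` ?S = K" using bij by (auto simp: bij_betw_def)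
  have mix: "(\<lambda>x. t * p x + (1 - t) * q x) \<in> ?S" if "p \<in> ?S" "q \<in> ?S" "0 \<le> t" "t \<le> 1" for p q t
  proof -
    have "linear (\<lambda>x. t * p x + (1 - t) * q x)"
      using that by (auto simp: state_space_eq positive_def linear_iff algebra_simps)
    then show ?thesis using that by (simp add: state_space_eq positive_def)
  qed
  \<comment> \<open>The map \<open>\<phi>\<close> respects convex combinations and is injective, so
    it carries extremality over in both directions.\<close>
  have ext_iff: "extreme_fun ?S w \<longleftrightarrow> \<phi> w extreme_point_of K" if w: "w \<in> ?S" for w
  proof -
    have "w = (\<lambda>x. t * p x + (1 - t) * q x) \<longleftrightarrow> \<phi> w = t *\<^sub>R \<phi> p + (1 - t) *\<^sub>R \<phi> q"
      if "p \<in> ?S" "q \<in> ?S" "0 < t" "t < 1" for p q t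
      using inj_on_eq_iff[OF inj w mix[OF that(1,2), of t]] aff[OF that(1,2), of t] that by simp
    moreover have "p = q \<longleftrightarrow> \<phi> p = \<phi> q" if "p \<in> ?S" "q \<in> ?S" for p q
      using inj_on_eq_iff[OF inj that] by simp
    ultimately have "extreme_fun ?S w \<longleftrightarrow>
        (\<forall>p\<in>?S. \<forall>q\<in>?S. \<forall>t. 0 < t \<and> t < 1 \<and> \<phi> w = t *\<^sub>R \<phi> p + (1 - t) *\<^sub>R \<phi> q \<longrightarrow> \<phi> p = \<phi> q)"
      using w unfolding extreme_fun_def by blast
    \<comment> \<open>Renaming the endpoints and swapping the summands matches the parametrization
      of open segments in \<open>in_segment\<close>.\<close>
    also have "\<dots> \<longleftrightarrow> (\<forall>a\<in>K. \<forall>b\<in>K. \<forall>t. 0 < t \<and> t < 1 \<and> \<phi> w = t *\<^sub>R b + (1 - t) *\<^sub>R a \<longrightarrow> b = a)"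
      unfolding onto[symmetric] by blast
    also have "\<dots> \<longleftrightarrow> (\<forall>a\<in>K. \<forall>b\<in>K. \<forall>t. 0 < t \<and> t < 1 \<and> \<phi> w = (1 - t) *\<^sub>R a + t *\<^sub>R b \<longrightarrow> b = a)"
      by (simp only: add.commute)
    also have "\<dots> \<longleftrightarrow> \<phi> w extreme_point_of K"
    proof -
      have "\<phi> w \<in> K" using w onto by blast
      then show ?thesis unfolding extreme_point_of_def in_segment by metis
    qed
    finally show ?thesis .
  qed
  obtain w' x' y' z' s t where extr: "w' extreme_point_of K" "x' extreme_point_of K"
      "y' extreme_point_of K" "z' extreme_point_of K"
    and st: "0 < s" "s < 1" "0 < t" "t < 1"
    and eq: "s *\<^sub>R w' + (1 - s) *\<^sub>R x' = t *\<^sub>R y' + (1 - t) *\<^sub>R z'" and ne: "w' \<noteq> y'" "w' \<noteq> z'"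
    using assms(4) unfolding is_simplex_def by blast
  then have "w' \<in> \<phi> ` ?S" "x' \<in> \<phi> ` ?S" "y' \<in> \<phi> ` ?S" "z' \<in> \<phi> ` ?S"
    unfolding onto extreme_point_of_def by blast+
  then obtain w x y z where S: "w \<in> ?S" "x \<in> ?S" "y \<in> ?S" "z \<in> ?S"
    and \<phi>: "w' = \<phi> w" "x' = \<phi> x" "y' = \<phi> y" "z' = \<phi> z"
    by blast
  have pure: "extreme_fun ?S w" "extreme_fun ?S y" "extreme_fun ?S z"
    using extr S ext_iff \<phi> by blast+
  have "\<phi> (\<lambda>a. s * w a + (1 - s) * x a) = \<phi> (\<lambda>a. t * y a + (1 - t) * z a)"
    using eq S st aff \<phi> by simp
  then have "(\<lambda>a. s * w a + (1 - s) * x a) = (\<lambda>a. t * y a + (1 - t) * z a)"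
    using inj_onD[OF inj] S st mix by simp
  then have rel: "s * w a + (1 - s) * x a = t * y a + (1 - t) * z a" for a
    by meson
  have "\<exists>v. extreme_fun ?S v \<and> \<not> tracial v"
  proof (rule ccontr)
    assume "\<not> ?thesis"
    then have mult: "f (jp a b) = f a * f b" if "f \<in> {w, y, z}" for f a b
      using that pure pure_tracial_multiplicative by blast
    have lin: "linear f" and unit: "f u = 1" if "f \<in> {w, y, z}" for f
      using that S by (auto simp: state_space_def)
    obtain a b where ab: "w a \<noteq> y a" "w b \<noteq> z b" using ne \<phi> by (metis ext)
    \<comment> \<open>By multiplicativity the first factor is killed by \<open>y\<close> and the
      second by \<open>z\<close>, while \<open>w\<close> is nonzero on both.\<close>
    define e where "e = jp (a - y a *\<^sub>R u) (b - z b *\<^sub>R u)"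
    have e: "f e = (f a - y a) * (f b - z b)" if "f \<in> {w, y, z}" for f
      by (simp add: e_def mult[OF that] linear_diff[OF lin[OF that]] linear_scale[OF lin[OF that]] unit[OF that])
    \<comment> \<open>Evaluated at the square of \<open>e\<close>, the right side of
      \<open>rel\<close> vanishes. The left side is positive: its first term is positive and its
      second nonnegative.\<close>
    have "s * (w e * w e) + (1 - s) * x (jp e e) = 0"
      using rel[of "jp e e"] mult[of w] mult[of y] mult[of z] e[of y] e[of z] by simp
    moreover have "x (jp e e) \<ge> 0" using S by (simp add: state_space_def)
    moreover have "w e \<noteq> 0" using ab e[of w] by simp
    then have "w e * w e > 0" using not_real_square_gt_zero by blast
    ultimately show False
      using st by (smt (verit) mult_nonneg_nonneg mult_pos_pos)
  qed
  then obtain v where "extreme_fun ?S v" "\<not> tracial v" by blast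
  then obtain g :: "real \<Rightarrow> 'a \<Rightarrow> real" where g: "inj g" "\<And>r. extreme_fun ?S (g r)"
    using pure_state_orbit by metis
  then have gS: "g r \<in> ?S" for r by (simp add: extreme_fun_def)
  have "inj (\<lambda>r. \<phi> (g r))"
    using inj g(1) gS by (auto intro!: injI dest: inj_onD injD)
  moreover have "\<phi> (g r) extreme_point_of K" for r
    using ext_iff[OF gS] g(2) by blast
  ultimately show ?thesis by blast
qed

end
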